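(* Let $b\ge2$ be an integer with $b\equiv 87\pmod{11184810}$ and let $t$ be a positive integer with $t\equiv 59\pmod{120}$. Then the $b$-repdigit $41_b^{(t)}=41(b^t-1)/(b-1)$ is a Sierpiński number.
   Context: For integers $b\ge2$, $1\le k<b$, $t\ge1$, the $b$-repdigit $k_b^{(t)}$ is $k(b^t-1)/(b-1)$. A Sierpiński number is an odd positive integer $k$ such that $k\cdot 2^n+1$ is composite for all positive integers $n$. *)

theory Defs
  imports "HOL-Number_Theory.Number_Theory"
begin

text \<open>
  The base-\<open>b\<close> numeral consisting of \<open>t\<close> digits \<open>k\<close>, meant for \<open>b \<ge> 2\<close>, \<open>1 \<le> k < b\<close> and
  \<open>t \<ge> 1\<close>. In this range neither subtraction is truncated, and the division is exact because
  \<open>b - 1\<close> divides \<open>b ^ t - 1\<close>.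
\<close>

definition repdigit :: "nat \<Rightarrow> nat \<Rightarrow> nat \<Rightarrow> nat" where
  "repdigit b k t = k * (b ^ t - 1) div (b - 1)"

definition composite :: "nat \<Rightarrow> bool" where
  "composite n \<longleftrightarrow> n > 1 \<and> \<not> prime n"

definition sierpinski_number :: "nat \<Rightarrow> bool" where
  "sierpinski_number k \<longleftrightarrow> k > 0 \<and> odd k \<and> (\<forall>n>0. composite (k * 2 ^ n + 1))"

end

theory Submission
  imports Defs
begin

text \<open>
  The modulus is \<open>11184810 = 2 * 3 * 5 * 7 * 13 * 17 * 241\<close>. It divides
  \<open>87 * (1 + 87 + \<dots> + 87 ^ 119)\<close>, so for positive \<open>t\<close> the residue of \<open>1 + b + \<dots> + b ^ (t - 1)\<close>
  depends only on \<open>t\<close> modulo \<open>120\<close>, and the repdigit is congruent to a fixed odd number \<open>k\<close>. The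
  order of \<open>2\<close> modulo each of the six odd primes divides \<open>24\<close>, and for every residue class of \<open>n\<close>
  modulo \<open>24\<close> one of these primes divides \<open>k * 2 ^ n + 1\<close>.
\<close>

lemma sum_powers_mult_nat:
  fixes b :: nat
  assumes "b \<ge> 1"
  shows "(b - 1) * (\<Sum>i<t. b ^ i) = b ^ t - 1"
proof -
  have "int ((b - 1) * (\<Sum>i<t. b ^ i)) = int (b ^ t - 1)"
    using assms power_diff_1_eq[of "int b" t] by (simp add: of_nat_diff)
  then show ?thesis by (simp only: of_nat_eq_iff)
qed

lemma repdigit_eq_sum:
  assumes "b \<ge> 2"
  shows "repdigit b k t = k * (\<Sum>i<t. b ^ i)"
proof -
  have "b ^ t - 1 = (b - 1) * (\<Sum>i<t. b ^ i)"
    using sum_powers_mult_nat[of b t] assms by simp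
  then have "repdigit b k t = (b - 1) * (k * (\<Sum>i<t. b ^ i)) div (b - 1)"
    by (simp only: repdigit_def mult.left_commute)
  also have "\<dots> = k * (\<Sum>i<t. b ^ i)"
    by (rule nonzero_mult_div_cancel_left) (use assms in simp)
  finally show ?thesis .
qed

lemma sum_powers_add:
  fixes b :: "'a::comm_semiring_1"
  shows "(\<Sum>i<m + n. b ^ i) = (\<Sum>i<m. b ^ i) + b ^ m * (\<Sum>i<n. b ^ i)"
  by (induction n) (simp_all add: algebra_simps power_add)

text \<open>Each extra block of \<open>T\<close> terms is \<open>b ^ s * (\<Sum>i<T. b ^ i)\<close>
  times a power of \<open>b\<close>. Keeping the factor \<open>b ^ s\<close> allows \<open>b\<close>
  and \<open>m\<close> to share prime factors.\<close>

lemma cong_sum_powers_period: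
  fixes b m :: nat
  assumes "m dvd b ^ s * (\<Sum>i<T. b ^ i)"
  shows "[(\<Sum>i<s + T * j. b ^ i) = (\<Sum>i<s. b ^ i)] (mod m)"
proof (induction j)
  case (Suc j)
  have "(\<Sum>i<s + T * Suc j. b ^ i)
      = (\<Sum>i<s + T * j. b ^ i) + b ^ (T * j) * (b ^ s * (\<Sum>i<T. b ^ i))"
    using sum_powers_add[of b "s + T * j" T] by (simp add: power_add algebra_simps)
  also have "[\<dots> = (\<Sum>i<s. b ^ i) + 0] (mod m)"
    using Suc assms by (intro cong_add) (auto simp: cong_0_iff)
  finally show ?case by simp
qed simp

text \<open>Horner's scheme keeps the evaluation of these residues by the simplifier within small numbers.\<close>

lemma sum_powers_numeral_mod:
  fixes b m :: nat
  shows "(\<Sum>i<numeral n. b ^ i) mod m = (b * ((\<Sum>i<pred_numeral n. b ^ i) mod m) + 1) mod m"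
proof -
  have "(\<Sum>i<Suc j. b ^ i) = b * (\<Sum>i<j. b ^ i) + 1" for j
    using sum_powers_add[of b 1 j] by simp
  then show ?thesis
    by (metis numeral_eq_Suc mod_add_left_eq mod_mult_right_eq)
qed

lemma sum_powers_87_59: "[(\<Sum>i<59. 87 ^ i) = 7353187] (mod (11184810 :: nat))"
  by (simp add: cong_def sum_powers_numeral_mod lessThan_Suc)

text \<open>Since \<open>87\<close> is divisible by 3, the sum is 1 modulo 3; the factor 3 comes
  from the power of \<open>87\<close>, and the cofactor \<open>3728270\<close> from the sum.\<close>

lemma sum_powers_87_120: "11184810 dvd 87 ^ 59 * (\<Sum>i<120. 87 ^ i :: nat)"
proof -
  have "(3::nat) dvd 87 ^ 59"
    by (rule dvd_trans[of _ 87], simp, rule dvd_power, simp)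
  moreover have "3728270 dvd (\<Sum>i<120. 87 ^ i :: nat)"
    unfolding dvd_eq_mod_eq_0 by (simp add: sum_powers_numeral_mod lessThan_Suc)
  moreover have "11184810 = 3 * (3728270 :: nat)" by simp
  ultimately show ?thesis by (simp only: mult_dvd_mono)
qed

lemma composite_if_prime_dvd:
  assumes "prime p" "p dvd m" "p < m"
  shows "composite m"
  using assms prime_nat_iff[of m] prime_gt_1_nat[of p] by (auto simp: composite_def)

lemma two_power_cong_mod_24:
  fixes p :: nat
  assumes "[2 ^ 24 = 1] (mod p)"
  shows "[2 ^ n = 2 ^ (n mod 24)] (mod p)"
proof -
  have "2 ^ n = (2 ^ 24) ^ (n div 24) * (2::nat) ^ (n mod 24)"
    by (metis mult_div_mod_eq power_add power_mult)
  also have "[\<dots> = 1 ^ (n div 24) * 2 ^ (n mod 24)] (mod p)"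
    by (intro cong_mult cong_pow assms cong_refl)
  finally show ?thesis by simp
qed

text \<open>The prime 3 serves even \<open>n\<close>, 5 serves 1 mod 4, 7 serves 2 mod 3, 13 serves
  7 mod 12, 17 serves 7 mod 8, and 241 serves 3 mod 24; these classes cover all residues.\<close>

lemma covering_mod_24:
  assumes "(n::nat) < 24"
  shows "\<exists>p\<in>{3, 5, 7, 13, 17, 241::nat}. p dvd 10675607 * 2 ^ n + 1"
proof -
  have "n \<in> {0, 1, 2, 3, 4, 5, 6, 7, 8, 9, 10, 11,
      12, 13, 14, 15, 16, 17, 18, 19, 20, 21, 22, 23}"
    using assms by simp presburger
  then show ?thesis
    by (elim insertE emptyE) simp_all
qed

theorem theorem3p9:
  fixes b t :: nat
  assumes "b \<ge> 2" and "[b = 87] (mod 11184810)"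
    and "t > 0" and "[t = 59] (mod 120)"
  shows "sierpinski_number (repdigit b 41 t)"
proof -
  define k where "k = repdigit b 41 t"
  have k_sum: "k = 41 * (\<Sum>i<t. b ^ i)"
    unfolding k_def using assms(1) by (rule repdigit_eq_sum)
  have t_mod: "t mod 120 = 59" using assms(4) by (simp add: cong_def)
  then have t_eq: "t = 59 + 120 * (t div 120)"
    using mod_mult_div_eq[of t 120] by (simp only:)
  have "[(\<Sum>i<t. b ^ i) = (\<Sum>i<t. 87 ^ i)] (mod 11184810)"
    by (intro cong_sum cong_pow assms(2))
  also have "[(\<Sum>i<t. 87 ^ i) = (\<Sum>i<59. 87 ^ i)] (mod (11184810::nat))"
    by (subst t_eq, rule cong_sum_powers_period) (rule sum_powers_87_120)
  also note sum_powers_87_59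
  finally have "[k = 41 * 7353187] (mod 11184810)"
    unfolding k_sum by (rule cong_scalar_left)
  then have k_cong: "[k = 10675607] (mod 11184810)"
    by (simp add: cong_def)
  \<comment> \<open>The modulus is even, so the congruence also fixes the parity.\<close>
  then have "odd k"
    using cong_dvd_modulus_nat[OF k_cong, of 2] by (simp add: cong_def odd_iff_mod_2_eq_one)
  \<comment> \<open>With at least 59 terms, each at least 1, \<open>k\<close> is at least
    \<open>41 * 59\<close>, above the largest covering prime; hence that prime will be a proper
    divisor.\<close>
  have "59 \<le> t" using t_eq by linarith
  also have "t = (\<Sum>i<t. 1)" by simp
  also have "\<dots> \<le> (\<Sum>i<t. b ^ i)" by (intro sum_mono) (use assms(1) in simp)
  finally have k_large: "k > 241" by (simp add: k_sum)
  have "composite (k * 2 ^ n + 1)" for n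
  proof -
    obtain p where p: "p \<in> {3, 5, 7, 13, 17, 241::nat}" "p dvd 10675607 * 2 ^ (n mod 24) + 1"
      using covering_mod_24[of "n mod 24"] by auto
    have "[2 ^ 24 = 1] (mod p)" "p dvd 11184810" "p \<le> 241" "prime p"
      using p(1) by (auto simp: cong_def dvd_eq_mod_eq_0)
    then have "[k * 2 ^ n + 1 = 10675607 * 2 ^ (n mod 24) + 1] (mod p)"
      by (intro cong_add cong_mult two_power_cong_mod_24 cong_dvd_modulus_nat[OF k_cong] cong_refl)
    with p(2) have "p dvd k * 2 ^ n + 1" by (simp add: cong_dvd_iff)
    moreover have "k * 1 \<le> k * 2 ^ n" by (intro mult_le_mono2) simp
    then have "p < k * 2 ^ n + 1" using \<open>p \<le> 241\<close> k_large by linarith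
    ultimately show ?thesis by (intro composite_if_prime_dvd[OF \<open>prime p\<close>])
  qed
  with \<open>odd k\<close> k_large show ?thesis
    by (simp add: sierpinski_number_def flip: k_def)
qed

end
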